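(* There is an absolute constant $C>0$ such that for every $M$ there is a finite set $P\subset\mathbb{R}^2$ with $|P|\ge M$, $|P|\ge2$, and $$\max_{p\in P}\bigl|\{p\cdot q:q\in P\}\bigr|\ \le\ \frac{C\,|P|}{\sqrt{\log|P|}}.$$
   Context: $p\cdot q$ is the standard inner product on $\mathbb{R}^2$, and $\log$ is the natural logarithm. *)

theory Defs
  imports "HOL-Analysis.Analysis"
begin

end

theory Submission
  imports Defs
begin

text \<open>
  Take \<open>d\<close> rays at angles \<open>i \<pi> / d\<close> and put the same finite set \<open>S\<close> of radii on each of them. Seen
  from the point of radius \<open>s\<close> on ray \<open>i\<close>, the dot products are \<open>s\<close> times numbers
  \<open>t cos ((i - j) \<pi> / d)\<close> with \<open>t \<in> S\<close>. Only the \<open>d\<close> values \<open>g j = \<bar>cos (j \<pi> / d)\<bar>\<close> occur, so if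
  \<open>S\<close> is a set of monomials in the \<open>g j\<close> that hardly grows under multiplication by a generator,
  there are \<open>O(\<bar>S\<bar>) = O(\<bar>P\<bar> / d)\<close> of them. The monomials with exponents at most \<open>k\<close> number at most
  \<open>(k + 1)\<^sup>d\<close>, so some \<open>k < d\<^sup>2\<close> has growth factor at most 4, which makes
  \<open>ln \<bar>P\<bar> = O(d\<^sup>2)\<close>.
\<close>

text \<open>Values are collected, not exponent vectors: the cosines used later repeat
  (\<open>cos (pi - x) = - cos x\<close>), so different exponents can give the same radius.\<close>

definition monomials :: "(nat \<Rightarrow> real) \<Rightarrow> nat \<Rightarrow> nat \<Rightarrow> real set" where
  "monomials g d k = (\<lambda>e. \<Prod>i<d. g i ^ e i) ` ({..<d} \<rightarrow>\<^sub>E {..k})"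

lemma finite_monomials: "finite (monomials g d k)"
  unfolding monomials_def by (intro finite_imageI finite_PiE) auto

lemma monomials_nonempty: "monomials g d k \<noteq> {}"
  unfolding monomials_def by (simp add: PiE_eq_empty_iff)

lemma card_monomials_pos: "card (monomials g d k) > 0"
  using finite_monomials monomials_nonempty by (simp add: card_gt_0_iff)

lemma card_monomials_le: "card (monomials g d k) \<le> (k + 1) ^ d"
proof -
  have "card (monomials g d k) \<le> card ({..<d} \<rightarrow>\<^sub>E {..k})"
    unfolding monomials_def by (intro card_image_le finite_PiE) auto
  also have "\<dots> = (k + 1) ^ d"
    by (simp add: card_PiE)
  finally show ?thesis .
qed

lemma monomials_pos:
  assumes "\<And>i. g i > 0" and "s \<in> monomials g d k"
  shows "s > 0"
  using assms by (auto simp: monomials_def intro!: prod_pos)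

lemma monomials_mult:
  assumes "j < d" and "s \<in> monomials g d k"
  shows "g j * s \<in> monomials g d (Suc k)"
proof -
  obtain e where e: "e \<in> {..<d} \<rightarrow>\<^sub>E {..k}" and s: "s = (\<Prod>i<d. g i ^ e i)"
    using assms(2) by (auto simp: monomials_def)
  let ?e = "e(j := Suc (e j))"
  have "(\<Prod>i<d. g i ^ ?e i) = g j ^ Suc (e j) * (\<Prod>i\<in>{..<d} - {j}. g i ^ ?e i)"
    using assms(1) by (subst prod.remove[of _ j]) auto
  also have "(\<Prod>i\<in>{..<d} - {j}. g i ^ ?e i) = (\<Prod>i\<in>{..<d} - {j}. g i ^ e i)"
    by (intro prod.cong) auto
  also have "g j ^ Suc (e j) * \<dots> = g j * s"
    using assms(1) by (simp add: s prod.remove[of "{..<d}" j])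
  finally have "g j * s = (\<Prod>i<d. g i ^ ?e i)" by simp
  moreover have "?e \<in> {..<d} \<rightarrow>\<^sub>E {..Suc k}"
  proof (rule PiE_I)
    fix i assume "i \<in> {..<d}"
    then have "e i \<le> k" and "e j \<le> k" using e assms(1) by (auto simp: PiE_iff)
    then show "?e i \<in> {..Suc k}" by simp
  next
    fix i assume "i \<notin> {..<d}"
    then show "?e i = undefined" using e assms(1) by (auto simp: PiE_iff extensional_def)
  qed
  ultimately show ?thesis
    unfolding monomials_def by blast
qed

text \<open>Raised to the power \<open>d\<close>, this puts the polynomial bound
  \<open>(d * d + 1) ^ d\<close> on the number of monomials below
  \<open>4 ^ (d * d)\<close>.\<close>

lemma square_add_one_less_four_power:
  fixes d :: nat
  assumes "d \<ge> 1"
  shows "d * d + 1 < 4 ^ d"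
  using assms
proof (induction d rule: dec_induct)
  case (step n)
  have "Suc n * Suc n + 1 = n * n + 2 * n + 2" by simp
  also have "\<dots> \<le> 4 * (n * n + 1)" by (cases n) auto
  also have "\<dots> < 4 * 4 ^ n" using step.IH by simp
  finally show ?case by simp
qed simp

text \<open>If each of the first \<open>d * d\<close> levels grew by a factor above 4, level
  \<open>d * d\<close> would have at least \<open>4 ^ (d * d)\<close> elements, more than there are
  exponent vectors to supply.\<close>

lemma small_growth:
  assumes "d \<ge> 1"
  obtains k where "k < d * d" and "card (monomials g d (Suc k)) \<le> 4 * card (monomials g d k)"
proof -
  have "\<exists>k<d * d. card (monomials g d (Suc k)) \<le> 4 * card (monomials g d k)"
  proof (rule ccontr)
    assume "\<not> ?thesis"
    then have growth: "4 * card (monomials g d k) < card (monomials g d (Suc k))" if "k < d * d" for k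
      using that by (auto simp: not_le)
    have "4 ^ k \<le> card (monomials g d k)" if "k \<le> d * d" for k
      using that
    proof (induction k)
      case 0
      show ?case using card_monomials_pos[of g d 0] by simp
    next
      case (Suc k)
      then show ?case using growth[of k] by simp
    qed
    then have "4 ^ (d * d) \<le> card (monomials g d (d * d))" by blast
    also have "\<dots> \<le> (d * d + 1) ^ d" by (rule card_monomials_le)
    also have "\<dots> < (4 ^ d) ^ d"
      using square_add_one_less_four_power[OF assms] assms
      by (intro power_strict_mono) auto
    also have "\<dots> = (4::nat) ^ (d * d)" by (simp add: power_mult)
    finally show False by simp
  qed
  then show ?thesis using that by blast
qed

definition polar :: "real \<Rightarrow> real \<Rightarrow> real ^ 2" where
  "polar r \<theta> = vector [r * cos \<theta>, r * sin \<theta>]"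

lemma inner_polar: "polar r \<theta> \<bullet> polar s \<phi> = r * s * cos (\<theta> - \<phi>)"
  by (simp add: polar_def inner_vec_def sum_2 cos_diff algebra_simps)

lemma polar_inject:
  assumes "polar r \<theta> = polar s \<phi>" and "r > 0" "s > 0" and "\<theta> \<in> {0..pi}" "\<phi> \<in> {0..pi}"
  shows "r = s" and "\<theta> = \<phi>"
proof -
  have "r\<^sup>2 = s\<^sup>2"
    using assms(1) inner_polar[of r \<theta> r \<theta>] inner_polar[of s \<phi> s \<phi>] by (simp add: power2_eq_square)
  then show "r = s" using assms by (simp add: power2_eq_iff_nonneg)
  have "r * cos \<theta> = s * cos \<phi>"
    using assms(1) unfolding polar_def by (metis vector_2(1))
  then have "cos \<theta> = cos \<phi>" using \<open>r = s\<close> assms(2) by simp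
  then show "\<theta> = \<phi>" using assms(4,5) by (auto intro: cos_inj_pi)
qed

text \<open>For \<open>i < d\<close> the rays lie within a half turn, where the cosine alone
  determines the angle; equal spacing makes every difference of two ray angles again a ray angle up
  to sign.\<close>

definition ray_angle :: "nat \<Rightarrow> nat \<Rightarrow> real" where
  "ray_angle d i = real i * pi / real d"

definition ray_points :: "nat \<Rightarrow> real set \<Rightarrow> (real ^ 2) set" where
  "ray_points d S = (\<lambda>(i, s). polar s (ray_angle d i)) ` ({..<d} \<times> S)"

lemma card_ray_points:
  assumes "\<And>s. s \<in> S \<Longrightarrow> s > 0"
  shows "card (ray_points d S) = d * card S"
proof -
  have angle: "ray_angle d i \<in> {0..pi}" if "i < d" for i
    using that by (simp add: ray_angle_def divide_le_eq mult.commute)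
  have "inj_on (\<lambda>(i, s). polar s (ray_angle d i)) ({..<d} \<times> S)"
  proof (rule inj_onI, clarify)
    fix i s j t
    assume "i < d" "j < d" "s \<in> S" "t \<in> S" and eq: "polar s (ray_angle d i) = polar t (ray_angle d j)"
    then have "s = t" "ray_angle d i = ray_angle d j"
      using polar_inject[OF eq] assms angle by auto
    then show "i = j \<and> s = t" using \<open>i < d\<close> by (simp add: ray_angle_def)
  qed
  then show ?thesis
    by (simp add: ray_points_def card_image card_cartesian_product)
qed

text \<open>The value 1 replaces a vanishing cosine, so that all monomials are positive.\<close>

definition ray_cos :: "nat \<Rightarrow> nat \<Rightarrow> real" where
  "ray_cos d j = (let c = cos (ray_angle d j) in if c = 0 then 1 else \<bar>c\<bar>)"

lemma ray_cos_pos: "ray_cos d j > 0"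
  by (simp add: ray_cos_def Let_def)

text \<open>As the cosine is even, only the distance of \<open>i\<close> and \<open>j\<close>
  matters, so \<open>d\<close> generators serve all pairs of rays. The value 0 is listed separately
  because \<open>ray_cos\<close> replaces it by 1.\<close>

lemma cos_ray_diff:
  assumes "i < d" "j < d"
  obtains m where "m < d"
    and "cos (ray_angle d i - ray_angle d j) \<in> {0, ray_cos d m, - ray_cos d m}"
proof -
  define m where "m = (if i \<ge> j then i - j else j - i)"
  have "ray_angle d i - ray_angle d j = ray_angle d m \<or>
      ray_angle d i - ray_angle d j = - ray_angle d m"
    by (simp add: m_def ray_angle_def of_nat_diff left_diff_distrib diff_divide_distrib)
  then have "cos (ray_angle d i - ray_angle d j) = cos (ray_angle d m)"
    by auto
  moreover have "m < d" using assms by (auto simp: m_def)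
  ultimately show ?thesis
    using that[of m] by (auto simp: ray_cos_def Let_def abs_if)
qed

text \<open>The radius \<open>s\<close> of \<open>p\<close> is a common factor of all the products.
  What remains is 0 or, up to sign, a generator times a monomial of level \<open>k\<close>, hence a
  monomial of level \<open>Suc k\<close>.\<close>

lemma card_inner_ray_points:
  assumes "p \<in> ray_points d (monomials (ray_cos d) d k)"
  shows "card {p \<bullet> q |q. q \<in> ray_points d (monomials (ray_cos d) d k)}
    \<le> 2 * card (monomials (ray_cos d) d (Suc k)) + 1"
proof -
  let ?T = "monomials (ray_cos d) d (Suc k)"
  obtain i s where i: "i < d" and p: "p = polar s (ray_angle d i)"
    using assms by (auto simp: ray_points_def)
  have sub: "{p \<bullet> q |q. q \<in> ray_points d (monomials (ray_cos d) d k)}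
    \<subseteq> insert 0 ((*) s ` ?T \<union> (*) (- s) ` ?T)"
  proof (rule subsetI)
    fix x assume "x \<in> {p \<bullet> q |q. q \<in> ray_points d (monomials (ray_cos d) d k)}"
    then obtain q j t where x: "x = p \<bullet> q" and j: "j < d" and t: "t \<in> monomials (ray_cos d) d k"
      and q: "q = polar t (ray_angle d j)"
      by (auto simp: ray_points_def)
    obtain m where m: "m < d"
      and c: "cos (ray_angle d i - ray_angle d j) \<in> {0, ray_cos d m, - ray_cos d m}"
      using cos_ray_diff[OF i j] by blast
    have "ray_cos d m * t \<in> ?T" using monomials_mult[OF m t] .
    moreover have "p \<bullet> q = 0 \<or> p \<bullet> q = s * (ray_cos d m * t) \<or> p \<bullet> q = - s * (ray_cos d m * t)"
      using c unfolding p q inner_polar by auto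
    ultimately show "x \<in> insert 0 ((*) s ` ?T \<union> (*) (- s) ` ?T)"
      unfolding x by blast
  qed
  have "card {p \<bullet> q |q. q \<in> ray_points d (monomials (ray_cos d) d k)}
    \<le> card (insert 0 ((*) s ` ?T \<union> (*) (- s) ` ?T))"
    using sub by (intro card_mono) (auto simp: finite_monomials)
  also have "\<dots> \<le> Suc (card ((*) s ` ?T \<union> (*) (- s) ` ?T))"
    by (simp add: card_insert_if finite_monomials)
  also have "\<dots> \<le> Suc (card ((*) s ` ?T) + card ((*) (- s) ` ?T))"
    using card_Un_le by simp
  also have "\<dots> \<le> Suc (card ?T + card ?T)"
    by (simp only: Suc_le_mono, intro add_mono card_image_le finite_monomials)
  finally show ?thesis by simp
qed

text \<open>Here \<open>c\<close> stands for the number of radii. The logarithm splits into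
  \<open>ln d \<le> d^2\<close> and \<open>ln c \<le> 2 * d^2\<close>, and 3 is rounded up to the
  square 4.\<close>

lemma sqrt_ln_card_le:
  fixes d c :: nat
  assumes "d \<ge> 1" "c \<ge> 1" "c \<le> 4 ^ (d * d)"
  shows "sqrt (ln (real (d * c))) \<le> 2 * real d"
proof -
  \<comment> \<open>\<open>ln 4 = 2 * ln 2\<close>, and \<open>ln (1 + x) \<le> x\<close> at
    \<open>x = 1\<close> gives \<open>ln 2 \<le> 1\<close>.\<close>
  have ln4: "ln (4::real) \<le> 2"
    using ln_add_one_self_le_self[of "1::real"] ln_realpow[of "2::real" 2] by simp
  have "ln (real c) \<le> ln (4 ^ (d * d))"
    using assms(2) of_nat_mono[OF assms(3), where 'a = real] by (intro ln_mono) auto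
  also have "\<dots> = real (d * d) * ln 4" by (simp add: ln_realpow)
  also have "\<dots> \<le> real (d * d) * 2" using ln4 by (intro mult_left_mono) auto
  finally have "ln (real c) \<le> 2 * real d ^ 2" by (simp add: power2_eq_square)
  moreover have "ln (real d) \<le> real d ^ 2"
    by (rule order_trans[OF ln_bound self_le_power]) (use assms(1) in auto)
  moreover have "ln (real (d * c)) = ln (real d) + ln (real c)"
    using assms by (simp add: ln_mult)
  moreover have "(2 * real d) ^ 2 = 4 * real d ^ 2"
    by (simp add: power_mult_distrib)
  ultimately have "ln (real (d * c)) \<le> (2 * real d) ^ 2"
    using zero_le_power2[of "real d"] by linarith
  then show ?thesis by (intro real_le_lsqrt) auto
qed

text \<open>The constant is 18 = 9 * 2: each point sees at most \<open>9 * card S\<close> products,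
  where \<open>card S = card P / d\<close>, and \<open>d\<close> is at least half of
  \<open>sqrt (ln (card P))\<close>.\<close>

lemma exists_few_dot_products:
  fixes d :: nat
  assumes "d \<ge> 2"
  obtains P :: "(real ^ 2) set" where "finite P" "card P \<ge> d"
    "\<And>p. p \<in> P \<Longrightarrow> real (card {p \<bullet> q |q. q \<in> P}) \<le> 18 * real (card P) / sqrt (ln (real (card P)))"
proof -
  have d1: "d \<ge> 1" using assms by simp
  obtain k where k: "k < d * d"
    and growth: "card (monomials (ray_cos d) d (Suc k)) \<le> 4 * card (monomials (ray_cos d) d k)"
    using small_growth[OF d1] by blast
  define S where "S = monomials (ray_cos d) d k"
  define P where "P = ray_points d S"
  have c1: "card S \<ge> 1" using card_monomials_pos[of "ray_cos d" d k] by (simp add: S_def)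
  have card_P: "card P = d * card S"
    unfolding P_def S_def by (intro card_ray_points monomials_pos[OF ray_cos_pos])
  have "card S \<le> (k + 1) ^ d" unfolding S_def by (rule card_monomials_le)
  \<comment> \<open>\<open>k < d * d\<close> gives \<open>k + 1 \<le> d * d < 4 ^ d\<close>.\<close>
  also have "\<dots> \<le> (4 ^ d) ^ d"
    using k square_add_one_less_four_power[OF d1] by (intro power_mono) auto
  also have "\<dots> = 4 ^ (d * d)" by (simp add: power_mult)
  finally have sqrt_le: "sqrt (ln (real (card P))) \<le> 2 * real d"
    unfolding card_P using sqrt_ln_card_le d1 c1 by blast
  have "card P \<ge> d" using c1 by (simp add: card_P)
  \<comment> \<open>At least two rays mean at least two points, so the logarithm is positive and the
    later division is by a nonzero number.\<close>
  then have sqrt_pos: "sqrt (ln (real (card P))) > 0" using assms by simp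
  show ?thesis
  proof (rule that)
    show "finite P" by (simp add: P_def S_def ray_points_def finite_monomials)
    show "card P \<ge> d" by fact
    fix p assume "p \<in> P"
    then have "card {p \<bullet> q |q. q \<in> P} \<le> 2 * card (monomials (ray_cos d) d (Suc k)) + 1"
      unfolding P_def S_def by (rule card_inner_ray_points)
    \<comment> \<open>Growth by at most 4 turns the two signs into \<open>8 * card S\<close>; the
      product 0 is absorbed by \<open>card S \<ge> 1\<close>.\<close>
    also have "\<dots> \<le> 9 * card S" using growth c1 by (simp add: S_def)
    finally have "real (card {p \<bullet> q |q. q \<in> P}) \<le> 9 * real (card S)"
      by linarith
    moreover have "9 * real (card S) * sqrt (ln (real (card P))) \<le> 9 * real (card S) * (2 * real d)"
      using sqrt_le by (intro mult_left_mono) auto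
    then have "9 * real (card S) \<le> 18 * real (card P) / sqrt (ln (real (card P)))"
      using sqrt_pos by (simp add: pos_le_divide_eq card_P mult_ac)
    ultimately show "real (card {p \<bullet> q |q. q \<in> P}) \<le> 18 * real (card P) / sqrt (ln (real (card P)))"
      by linarith
  qed
qed

theorem mainTheorem7:
  shows "\<exists>C::real. C > 0 \<and>
    (\<forall>M::nat. \<exists>P::(real ^ 2) set. finite P \<and> card P \<ge> M \<and> card P \<ge> 2 \<and>
      real (MAX p\<in>P. card {p \<bullet> q |q. q \<in> P}) \<le> C * real (card P) / sqrt (ln (real (card P))))"
proof (intro exI[of _ 18] conjI allI)
  fix M :: nat
  \<comment> \<open>Every ray carries a point, so \<open>max M 2\<close> rays meet both size
    requirements at once.\<close>
  obtain P :: "(real ^ 2) set" where P: "finite P" "card P \<ge> max M 2"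
    and few: "\<And>p. p \<in> P \<Longrightarrow>
      real (card {p \<bullet> q |q. q \<in> P}) \<le> 18 * real (card P) / sqrt (ln (real (card P)))"
    using exists_few_dot_products[of "max M 2"] by auto
  have "P \<noteq> {}" using P(2) by auto
  then have "(MAX p\<in>P. card {p \<bullet> q |q. q \<in> P}) \<in> (\<lambda>p. card {p \<bullet> q |q. q \<in> P}) ` P"
    using P(1) by (intro Max_in) auto
  then have "real (MAX p\<in>P. card {p \<bullet> q |q. q \<in> P}) \<le> 18 * real (card P) / sqrt (ln (real (card P)))"
    using few by auto
  then show "\<exists>P::(real ^ 2) set. finite P \<and> card P \<ge> M \<and> card P \<ge> 2 \<and>
      real (MAX p\<in>P. card {p \<bullet> q |q. q \<in> P}) \<le> 18 * real (card P) / sqrt (ln (real (card P)))"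
    using P by auto
qed simp

end
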